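(* Let $(X,\Phi)$ be a uniform space. Suppose that for every directed set $D$ there exist $D$-admissible ideals $\mathcal{I}$ and $\mathcal{K}$ on $D$ such that every $\mathcal{I}^{\mathcal{K}}$-Cauchy net $x\colon D\to X$ is $\mathcal{I}^{\mathcal{K}}$-convergent (to some point of $X$). Then $X$ is complete. If $X$ is a metric space (with its metric uniformity), it suffices to have such ideals for $D=\mathbb{N}$ (with the usual order).
   Context: An ideal on a set $S$ is a nonempty family of subsets of $S$ closed under subsets and finite unions; it is proper if it is not the whole power set of $S$. Its dual filter is $\mathcal{F}(\mathcal{I})=\{S\setminus A: A\in\mathcal{I}\}$. For $M\subseteq S$, $\mathcal{K}|_M=\{A\cap M: A\in\mathcal{K}\}$ is the trace ideal on $M$. For a directed set $(D,\le)$, $\mathcal{F}_D$ is the filter on $D$ generated by the sets $\{x\in D: x\ge d\}$, $d\in D$, and $\mathcal{I}_D$ is its dual ideal. An ideal $\mathcal{I}$ on $D$ is $D$-admissible if it is proper and $\mathcal{I}_D\subseteq\mathcal{I}$. Uniform spaces $(X,\Phi)$ are assumed Hausdorff ($\bigcap\Phi$ is the diagonal) and entourages $U\in\Phi$ are taken symmetric. $(X,\Phi)$ is complete if every Cauchy net in $X$ converges; for metric spaces it suffices to require this for sequences. A map $f\colon S\to X$ is $\mathcal{I}$-Cauchy if for every $U\in\Phi$ there exists $m\in S$ such that $\{n\in S: (f(n),f(m))\notin U\}\in\mathcal{I}$. It is $\mathcal{I}^{\mathcal{K}}$-Cauchy if there is $M\in\mathcal{F}(\mathcal{I})$ such that $f|_M\colon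 M\to X$ is $\mathcal{K}|_M$-Cauchy. It is $\mathcal{I}$-convergent to $x\in X$ if $f^{-1}(U)\in\mathcal{F}(\mathcal{I})$ for each neighborhood $U$ of $x$. It is $\mathcal{I}^{\mathcal{K}}$-convergent to $x$ if there is $M\in\mathcal{F}(\mathcal{I})$ such that $f|_M$ is $\mathcal{K}|_M$-convergent to $x$.
   Formalization: In both I^K-Cauchy and I^K-convergent the trace ideal K|_M is additionally required to be proper (M not in K); without this the claim fails, e.g. for the rationals, with I, K on N the sets having finitely many even, respectively odd, elements. *)

theory Defs
  imports Complex_Main
begin

section \<open>Ideals on a set\<close>

definition ideal_on :: "'s set \<Rightarrow> 's set set \<Rightarrow> bool" where
  "ideal_on S I \<longleftrightarrow> I \<subseteq> Pow S \<and> I \<noteq> {}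
     \<and> (\<forall>A\<in>I. \<forall>B. B \<subseteq> A \<longrightarrow> B \<in> I) \<and> (\<forall>A\<in>I. \<forall>B\<in>I. A \<union> B \<in> I)"

definition proper_ideal_on :: "'s set \<Rightarrow> 's set set \<Rightarrow> bool" where
  "proper_ideal_on S I \<longleftrightarrow> ideal_on S I \<and> I \<noteq> Pow S"

definition dual_filter :: "'s set \<Rightarrow> 's set set \<Rightarrow> 's set set" where
  "dual_filter S I = {S - A | A. A \<in> I}"

definition trace :: "'s set set \<Rightarrow> 's set \<Rightarrow> 's set set" where
  "trace K M = {A \<inter> M | A. A \<in> K}"


section \<open>Directed sets and nets\<close>

text \<open>A directed set is a carrier \<open>D\<close> with a preorder \<open>r\<close>, where \<open>(d, n) \<in> r\<close> means \<open>d \<le> n\<close>.\<close>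

definition directed_set :: "'d set \<Rightarrow> 'd rel \<Rightarrow> bool" where
  "directed_set D r \<longleftrightarrow> D \<noteq> {} \<and> preorder_on D r
     \<and> (\<forall>a\<in>D. \<forall>b\<in>D. \<exists>c\<in>D. (a, c) \<in> r \<and> (b, c) \<in> r)"

text \<open>The tails form a filter base on a directed set, so the filter they generate consists of
  their supersets.\<close>

definition tail_filter :: "'d set \<Rightarrow> 'd rel \<Rightarrow> 'd set set" where
  "tail_filter D r = {A. A \<subseteq> D \<and> (\<exists>d\<in>D. {n\<in>D. (d, n) \<in> r} \<subseteq> A)}"

definition tail_ideal :: "'d set \<Rightarrow> 'd rel \<Rightarrow> 'd set set" where
  "tail_ideal D r = {D - A | A. A \<in> tail_filter D r}"

definition admissible :: "'d set \<Rightarrow> 'd rel \<Rightarrow> 'd set set \<Rightarrow> bool" where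
  "admissible D r I \<longleftrightarrow> proper_ideal_on D I \<and> tail_ideal D r \<subseteq> I"


section \<open>Completeness of uniform spaces\<close>

definition entourages :: "('a::uniform_space \<times> 'a) set set" where
  "entourages = {U. eventually (\<lambda>p. p \<in> U) uniformity \<and> sym U}"

definition Cauchy_net :: "'d set \<Rightarrow> 'd rel \<Rightarrow> ('d \<Rightarrow> 'a::uniform_space) \<Rightarrow> bool" where
  "Cauchy_net D r f \<longleftrightarrow>
     (\<forall>U\<in>entourages. \<exists>d\<in>D. \<forall>m\<in>D. \<forall>n\<in>D. (d, m) \<in> r \<longrightarrow> (d, n) \<in> r \<longrightarrow> (f m, f n) \<in> U)"

definition net_convergent :: "'d set \<Rightarrow> 'd rel \<Rightarrow> ('d \<Rightarrow> 'a::topological_space) \<Rightarrow> 'a \<Rightarrow> bool" where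
  "net_convergent D r f x \<longleftrightarrow>
     (\<forall>U. eventually (\<lambda>y. y \<in> U) (nhds x) \<longrightarrow> (\<exists>d\<in>D. \<forall>n\<in>D. (d, n) \<in> r \<longrightarrow> f n \<in> U))"

text \<open>The first type argument bounds the directed sets that index the nets: they are the directed
  subsets of \<open>'e\<close>. A theorem that concludes \<open>net_complete TYPE('e) TYPE('a)\<close> for a type variable
  \<open>'e\<close> occurring nowhere else says that every Cauchy net in \<open>'a\<close> converges.
  As a hypothesis, on the other hand, a condition on all directed subsets of the one type
  \<open>('a \<times> 'a) set\<close> is weaker than the condition on all directed sets; that type contains the
  uniformity itself, directed by reverse inclusion.\<close>

definition net_complete :: "'e itself \<Rightarrow> 'a::uniform_space itself \<Rightarrow> bool" where
  "net_complete _ _ \<longleftrightarrow>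
     (\<forall>(E::'e set) r (f::'e \<Rightarrow> 'a). directed_set E r \<longrightarrow> Cauchy_net E r f \<longrightarrow>
        (\<exists>x. net_convergent E r f x))"


section \<open>Cauchy functions and convergence with respect to ideals\<close>

text \<open>A map defined on \<open>S\<close> is a total function of which only the values on \<open>S\<close> are used; so
  restricting it to \<open>M\<close> amounts to replacing \<open>S\<close> by \<open>M\<close>.\<close>

definition ideal_Cauchy :: "'s set \<Rightarrow> 's set set \<Rightarrow> ('s \<Rightarrow> 'a::uniform_space) \<Rightarrow> bool" where
  "ideal_Cauchy S I f \<longleftrightarrow> (\<forall>U\<in>entourages. \<exists>m\<in>S. {n\<in>S. (f n, f m) \<notin> U} \<in> I)"

definition ideal_convergent :: "'s set \<Rightarrow> 's set set \<Rightarrow> ('s \<Rightarrow> 'a::topological_space) \<Rightarrow> 'a \<Rightarrow> bool" where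
  "ideal_convergent S I f x \<longleftrightarrow>
     (\<forall>U. eventually (\<lambda>y. y \<in> U) (nhds x) \<longrightarrow> {n\<in>S. f n \<in> U} \<in> dual_filter S I)"

text \<open>The trace of \<open>K\<close> on \<open>M\<close> is required to be a proper ideal, so that its dual is a filter that
  does not contain the empty set. If \<open>M \<in> K\<close>, then the trace is the whole power set of \<open>M\<close>, and every
  map converges to every point with respect to it. This can happen for admissible \<open>I\<close> and \<open>K\<close>: on
  the natural numbers let \<open>I\<close> consist of the sets containing only finitely many even numbers and \<open>K\<close>
  of those containing only finitely many odd numbers, and let \<open>M\<close> be the set of even numbers.
  Without the requirement every sequence in every space would be convergent with respect to this
  pair. The requirement holds automatically if \<open>I\<close> is proper and \<open>K \<subseteq> I\<close>.\<close>

definition IK_Cauchy :: "'s set \<Rightarrow> 's set set \<Rightarrow> 's set set \<Rightarrow> ('s \<Rightarrow> 'a::uniform_space) \<Rightarrow> bool" where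
  "IK_Cauchy S I K f \<longleftrightarrow>
     (\<exists>M\<in>dual_filter S I. proper_ideal_on M (trace K M) \<and> ideal_Cauchy M (trace K M) f)"

definition IK_convergent ::
    "'s set \<Rightarrow> 's set set \<Rightarrow> 's set set \<Rightarrow> ('s \<Rightarrow> 'a::topological_space) \<Rightarrow> 'a \<Rightarrow> bool" where
  "IK_convergent S I K f x \<longleftrightarrow>
     (\<exists>M\<in>dual_filter S I. proper_ideal_on M (trace K M) \<and> ideal_convergent M (trace K M) f x)"

end

theory Submission
  imports Defs
begin

text \<open>
  A Cauchy net is eventually close to its own values, and the complements of tails belong to every
  admissible ideal \<open>K\<close>; so a Cauchy net is \<open>K\<close>-Cauchy on the whole index set, hence
  \<open>I\<^sup>K\<close>-Cauchy (lemma \<open>Cauchy_net_imp_IK_Cauchy\<close>). Conversely, an \<open>I\<^sup>K\<close>-limit of any net is a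
  cluster point of it: the set \<open>M\<close> on which the net \<open>K\<close>-converges has a proper trace ideal, whose
  dual filter contains the traces of all tails and of the preimages of all neighborhoods of the
  limit, so that these meet. Since a Cauchy net converges to each of its cluster points
  (lemma \<open>Cauchy_net_cluster_imp_convergent\<close>), the hypothesis on \<open>I\<close> and \<open>K\<close> makes all Cauchy nets
  indexed by that one directed set converge.

  It remains to pass from one index set to all. If the directed set \<open>D\<close> carries a decreasing base
  \<open>V\<close> of the uniformity, then an arbitrary Cauchy net \<open>f\<close> can be sampled along \<open>D\<close>: the sample at
  \<open>d\<close> is a value of \<open>f\<close> past which \<open>f\<close> moves by at most \<open>V d\<close>. The sampled net is Cauchy, and \<open>f\<close>
  converges to any limit of it (lemma \<open>net_complete_if_base_nets_converge\<close>). In a uniform space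
  the entourages themselves, ordered by reverse inclusion, form such a base; in a metric
  space the bands of width \<open>1 / (k + 1)\<close> form one that is indexed by the natural numbers.
\<close>


section \<open>Entourages and neighborhoods\<close>

lemma entourage_half:
  fixes U :: "('a::uniform_space \<times> 'a) set"
  assumes "U \<in> entourages"
  obtains W where "W \<in> entourages" "W O W \<subseteq> U"
proof -
  have "eventually (\<lambda>p. p \<in> U) uniformity"
    using assms by (simp add: entourages_def)
  then obtain D where D: "eventually D uniformity"
    and trans: "\<And>x y z. D (x, y) \<Longrightarrow> D (y, z) \<Longrightarrow> (x, z) \<in> U"
    by (rule uniformity_transE) blast
  define W where "W = {(x, y). D (x, y) \<and> D (y, x)}"
  have "eventually (\<lambda>(x, y). D (y, x)) uniformity"
    using uniformity_sym[OF D] .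
  then have "eventually (\<lambda>p. p \<in> W) uniformity"
    using D by eventually_elim (auto simp: W_def)
  moreover have "sym W"
    by (auto simp: W_def sym_def)
  ultimately have "W \<in> entourages"
    by (simp add: entourages_def)
  moreover have "W O W \<subseteq> U"
    using trans by (auto simp: W_def)
  ultimately show thesis ..
qed

lemma entourage_symD: "U \<in> entourages \<Longrightarrow> (x, y) \<in> U \<Longrightarrow> (y, x) \<in> U"
  by (auto simp: entourages_def dest: symD)

lemma entourage_Int: "U \<in> entourages \<Longrightarrow> W \<in> entourages \<Longrightarrow> U \<inter> W \<in> entourages"
  by (auto simp: entourages_def sym_Int eventually_conj)

lemma entourage_nhds: "U \<in> entourages \<Longrightarrow> eventually (\<lambda>y. y \<in> U `` {x}) (nhds x)"
  unfolding eventually_nhds_uniformity entourages_def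
  by (auto elim: eventually_mono)

lemma nhds_entourage_comp:
  fixes x :: "'a::uniform_space"
  assumes "eventually (\<lambda>y. y \<in> N) (nhds x)"
  obtains W where "W \<in> entourages" "(W O W) `` {x} \<subseteq> N"
proof -
  define U where "U = {(y, z). (y = x \<longrightarrow> z \<in> N) \<and> (z = x \<longrightarrow> y \<in> N)}"
  have ev: "eventually (\<lambda>(y, z). y = x \<longrightarrow> z \<in> N) uniformity"
    using assms by (simp add: eventually_nhds_uniformity)
  have "eventually (\<lambda>(y, z). z = x \<longrightarrow> y \<in> N) uniformity"
    using uniformity_sym[OF ev] by simp
  then have "eventually (\<lambda>p. p \<in> U) uniformity"
    using ev by eventually_elim (auto simp: U_def)
  moreover have "sym U"
    by (auto simp: U_def sym_def)
  ultimately have "U \<in> entourages"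
    by (simp add: entourages_def)
  then obtain W where "W \<in> entourages" "W O W \<subseteq> U"
    by (rule entourage_half)
  moreover have "U `` {x} \<subseteq> N"
    by (auto simp: U_def)
  ultimately show thesis
    using that by blast
qed


section \<open>Cauchy nets and admissible ideals\<close>

lemma ideal_on_empty: "ideal_on S I \<Longrightarrow> {} \<in> I"
  by (auto simp: ideal_on_def)

lemma dual_filter_iff:
  assumes "ideal_on S I"
  shows "A \<in> dual_filter S I \<longleftrightarrow> A \<subseteq> S \<and> S - A \<in> I"
proof
  assume "A \<in> dual_filter S I"
  then obtain B where B: "A = S - B" "B \<in> I"
    by (auto simp: dual_filter_def)
  moreover have "B \<subseteq> S"
    using assms B(2) by (auto simp: ideal_on_def)
  ultimately show "A \<subseteq> S \<and> S - A \<in> I"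
    by (simp add: double_diff)
next
  assume "A \<subseteq> S \<and> S - A \<in> I"
  then show "A \<in> dual_filter S I"
    unfolding dual_filter_def by (intro CollectI exI[of _ "S - A"]) (simp add: double_diff)
qed

lemma dual_filter_Int_nonempty:
  assumes "proper_ideal_on S I" "A \<in> dual_filter S I" "B \<in> dual_filter S I"
  shows "A \<inter> B \<noteq> {}"
proof
  assume "A \<inter> B = {}"
  have ideal: "ideal_on S I" and proper: "I \<noteq> Pow S"
    using assms(1) by (auto simp: proper_ideal_on_def)
  have "(S - A) \<union> (S - B) \<in> I"
    using assms(2,3) ideal by (auto simp: dual_filter_iff ideal_on_def)
  moreover have "(S - A) \<union> (S - B) = S"
    using \<open>A \<inter> B = {}\<close> by auto
  ultimately have "I = Pow S"
    using ideal by (auto simp: ideal_on_def)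
  with proper show False by simp
qed

lemma admissible_tail_complement:
  assumes "admissible D r K" "d \<in> D"
  shows "D - {n \<in> D. (d, n) \<in> r} \<in> K"
proof -
  have "{n \<in> D. (d, n) \<in> r} \<in> tail_filter D r"
    using assms(2) by (auto simp: tail_filter_def)
  then show ?thesis
    using assms(1) by (auto simp: admissible_def tail_ideal_def)
qed

lemma Cauchy_netD:
  "\<lbrakk>Cauchy_net D r f; U \<in> entourages\<rbrakk>
    \<Longrightarrow> \<exists>d\<in>D. \<forall>m\<in>D. \<forall>n\<in>D. (d, m) \<in> r \<longrightarrow> (d, n) \<in> r \<longrightarrow> (f m, f n) \<in> U"
  by (simp add: Cauchy_net_def)

lemma Cauchy_net_imp_IK_Cauchy:
  assumes dir: "directed_set D r" and I: "admissible D r I" and K: "admissible D r K"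
    and f: "Cauchy_net D r f"
  shows "IK_Cauchy D I K f"
proof -
  have idI: "ideal_on D I" and properK: "proper_ideal_on D K"
    using I K by (auto simp: admissible_def proper_ideal_on_def)
  then have idK: "ideal_on D K"
    by (simp add: proper_ideal_on_def)
  have "D \<in> dual_filter D I"
    using idI ideal_on_empty by (auto simp: dual_filter_iff)
  moreover have tr: "trace K D = K"
  proof -
    have "A \<inter> D = A" if "A \<in> K" for A
      using idK that by (auto simp: ideal_on_def)
    then show ?thesis
      by (auto simp: trace_def)
  qed
  moreover have "ideal_Cauchy D K f"
    unfolding ideal_Cauchy_def
  proof
    fix U :: "('b \<times> 'b) set" assume "U \<in> entourages"
    then obtain d where d: "d \<in> D"
      and close: "\<And>m n. \<lbrakk>m \<in> D; n \<in> D; (d, m) \<in> r; (d, n) \<in> r\<rbrakk> \<Longrightarrow> (f m, f n) \<in> U"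
      using Cauchy_netD[OF f] by blast
    have "(d, d) \<in> r"
      using dir d by (auto simp: directed_set_def preorder_on_def refl_on_def)
    then have "{n \<in> D. (f n, f d) \<notin> U} \<subseteq> D - {n \<in> D. (d, n) \<in> r}"
      using close d by auto
    then have "{n \<in> D. (f n, f d) \<notin> U} \<in> K"
      using admissible_tail_complement[OF K d] idK unfolding ideal_on_def by blast
    then show "\<exists>m\<in>D. {n \<in> D. (f n, f m) \<notin> U} \<in> K"
      using d by blast
  qed
  ultimately show ?thesis
    using properK unfolding IK_Cauchy_def by (intro bexI[of _ D]) simp_all
qed

text \<open>Properness of the trace on \<open>M\<close> is what makes the tail and the preimage of the neighborhood
  meet; admissibility of \<open>K\<close> puts the trace of the tail into the dual filter.\<close>

lemma IK_convergent_imp_cluster: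
  assumes K: "admissible D r K" and conv: "IK_convergent D I K f x"
    and d: "d \<in> D" and N: "eventually (\<lambda>y. y \<in> N) (nhds x)"
  shows "\<exists>n\<in>D. (d, n) \<in> r \<and> f n \<in> N"
proof -
  obtain M where M: "M \<in> dual_filter D I" and proper: "proper_ideal_on M (trace K M)"
    and lim: "ideal_convergent M (trace K M) f x"
    using conv unfolding IK_convergent_def by blast
  have "M \<subseteq> D"
    using M by (auto simp: dual_filter_def)
  have "{n \<in> M. f n \<in> N} \<in> dual_filter M (trace K M)"
    using lim N by (simp add: ideal_convergent_def)
  moreover have "{n \<in> M. (d, n) \<in> r} \<in> dual_filter M (trace K M)"
  proof -
    have "M - {n \<in> M. (d, n) \<in> r} = (D - {n \<in> D. (d, n) \<in> r}) \<inter> M"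
      using \<open>M \<subseteq> D\<close> by auto
    also have "\<dots> \<in> trace K M"
      using admissible_tail_complement[OF K d] by (auto simp: trace_def)
    finally show ?thesis
      using proper by (auto simp: proper_ideal_on_def dual_filter_iff)
  qed
  ultimately have "{n \<in> M. f n \<in> N} \<inter> {n \<in> M. (d, n) \<in> r} \<noteq> {}"
    by (rule dual_filter_Int_nonempty[OF proper])
  then show ?thesis
    using \<open>M \<subseteq> D\<close> by blast
qed

text \<open>One value near \<open>x\<close> in a tail whose values are mutually close carries the whole tail along;
  each of the two comparisons costs one factor of \<open>W O W\<close>.\<close>

lemma Cauchy_net_cluster_imp_convergent:
  assumes f: "Cauchy_net D r f"
    and cluster: "\<And>d N. \<lbrakk>d \<in> D; eventually (\<lambda>y. y \<in> N) (nhds x)\<rbrakk>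
                    \<Longrightarrow> \<exists>n\<in>D. (d, n) \<in> r \<and> f n \<in> N"
  shows "net_convergent D r f x"
  unfolding net_convergent_def
proof (intro allI impI)
  fix N assume "eventually (\<lambda>y. y \<in> N) (nhds x)"
  then obtain W where W: "W \<in> entourages" and WN: "(W O W) `` {x} \<subseteq> N"
    by (rule nhds_entourage_comp)
  obtain d where d: "d \<in> D"
    and close: "\<And>m n. \<lbrakk>m \<in> D; n \<in> D; (d, m) \<in> r; (d, n) \<in> r\<rbrakk> \<Longrightarrow> (f m, f n) \<in> W"
    using Cauchy_netD[OF f W] by blast
  obtain m where "m \<in> D" "(d, m) \<in> r" "f m \<in> W `` {x}"
    using cluster[OF d entourage_nhds[OF W]] by blast
  then have "\<forall>n\<in>D. (d, n) \<in> r \<longrightarrow> f n \<in> N"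
    using close WN by blast
  then show "\<exists>d\<in>D. \<forall>n\<in>D. (d, n) \<in> r \<longrightarrow> f n \<in> N"
    using d by blast
qed

lemma Cauchy_net_convergent_if_IK_complete:
  assumes dir: "directed_set D r" and I: "admissible D r I" and K: "admissible D r K"
    and complete: "\<And>g :: 'd \<Rightarrow> 'a::uniform_space.
                     IK_Cauchy D I K g \<Longrightarrow> \<exists>x. IK_convergent D I K g x"
    and f: "Cauchy_net D r (f :: 'd \<Rightarrow> 'a)"
  shows "\<exists>x. net_convergent D r f x"
proof -
  obtain x where "IK_convergent D I K f x"
    using complete Cauchy_net_imp_IK_Cauchy[OF dir I K f] by blast
  then have "net_convergent D r f x"
    using IK_convergent_imp_cluster[OF K] by (intro Cauchy_net_cluster_imp_convergent[OF f])
  then show ?thesis ..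
qed


section \<open>Sampling a net along a base of the uniformity\<close>

text \<open>The sample at \<open>d\<close> is \<open>f (s d)\<close>, where \<open>f\<close> moves by at most \<open>V d\<close> past \<open>s d\<close>. The choice
  \<open>s\<close> need not be monotone: the samples at \<open>d\<close> and \<open>e\<close> are compared through a value of \<open>f\<close> at a
  common upper bound of \<open>s d\<close> and \<open>s e\<close>.\<close>

lemma net_complete_if_base_nets_converge:
  fixes V :: "'d \<Rightarrow> ('a::uniform_space \<times> 'a) set"
  assumes dir: "directed_set D r"
    and V: "\<And>d. d \<in> D \<Longrightarrow> V d \<in> entourages"
    and antimono: "\<And>d e. \<lbrakk>d \<in> D; e \<in> D; (d, e) \<in> r\<rbrakk> \<Longrightarrow> V e \<subseteq> V d"
    and base: "\<And>U. U \<in> entourages \<Longrightarrow> \<exists>d\<in>D. V d \<subseteq> U"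
    and conv: "\<And>g :: 'd \<Rightarrow> 'a. Cauchy_net D r g \<Longrightarrow> \<exists>x. net_convergent D r g x"
  shows "net_complete TYPE('e) TYPE('a)"
  unfolding net_complete_def
proof (intro allI impI)
  fix E :: "'e set" and q and f :: "'e \<Rightarrow> 'a"
  assume E: "directed_set E q" and f: "Cauchy_net E q f"
  have "\<forall>d\<in>D. \<exists>a\<in>E. \<forall>m\<in>E. \<forall>n\<in>E. (a, m) \<in> q \<longrightarrow> (a, n) \<in> q \<longrightarrow> (f m, f n) \<in> V d"
    using Cauchy_netD[OF f V] by simp
  then obtain s where sE: "\<And>d. d \<in> D \<Longrightarrow> s d \<in> E"
    and close: "\<And>d m n. \<lbrakk>d \<in> D; m \<in> E; n \<in> E; (s d, m) \<in> q; (s d, n) \<in> q\<rbrakk>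
                  \<Longrightarrow> (f m, f n) \<in> V d"
    by metis
  have past: "(f (s d), f n) \<in> V d" if "d \<in> D" "n \<in> E" "(s d, n) \<in> q" for d n
  proof -
    have "(s d, s d) \<in> q"
      using E sE[OF that(1)] by (auto simp: directed_set_def preorder_on_def refl_on_def)
    then show ?thesis
      using close sE that by blast
  qed
  have upper: "\<exists>c\<in>E. (a, c) \<in> q \<and> (b, c) \<in> q" if "a \<in> E" "b \<in> E" for a b
    using E that by (auto simp: directed_set_def)
  have "Cauchy_net D r (f \<circ> s)"
    unfolding Cauchy_net_def
  proof
    fix U :: "('a \<times> 'a) set" assume "U \<in> entourages"
    then obtain W where W: "W \<in> entourages" "W O W \<subseteq> U"
      by (rule entourage_half)
    obtain d where d: "d \<in> D" "V d \<subseteq> W"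
      using base W(1) by blast
    have "(f (s m), f (s n)) \<in> U" if mn: "m \<in> D" "n \<in> D" "(d, m) \<in> r" "(d, n) \<in> r" for m n
    proof -
      obtain c where c: "c \<in> E" "(s m, c) \<in> q" "(s n, c) \<in> q"
        using upper sE mn by blast
      have "(f (s m), f c) \<in> W" "(f (s n), f c) \<in> W"
        using past c mn antimono d by blast+
      then show ?thesis
        using entourage_symD[OF W(1)] W(2) by blast
    qed
    then show "\<exists>d\<in>D. \<forall>m\<in>D. \<forall>n\<in>D. (d, m) \<in> r \<longrightarrow> (d, n) \<in> r
                 \<longrightarrow> ((f \<circ> s) m, (f \<circ> s) n) \<in> U"
      using d(1) by auto
  qed
  then obtain x where x: "net_convergent D r (f \<circ> s) x"
    using conv by blast
  have "net_convergent E q f x"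
    unfolding net_convergent_def
  proof (intro allI impI)
    fix N assume "eventually (\<lambda>y. y \<in> N) (nhds x)"
    then obtain W where W: "W \<in> entourages" and WN: "(W O W) `` {x} \<subseteq> N"
      by (rule nhds_entourage_comp)
    obtain d where d: "d \<in> D" and near: "\<And>n. \<lbrakk>n \<in> D; (d, n) \<in> r\<rbrakk> \<Longrightarrow> f (s n) \<in> W `` {x}"
      using x entourage_nhds[OF W, of x] unfolding net_convergent_def comp_def by blast
    obtain b where b: "b \<in> D" "V b \<subseteq> W"
      using base W by blast
    \<comment> \<open>Beyond \<open>d\<close> the sample is near \<open>x\<close>; beyond \<open>b\<close> it is near the rest of its net.\<close>
    obtain e where e: "e \<in> D" "(d, e) \<in> r" "(b, e) \<in> r"
      using dir d b(1) unfolding directed_set_def by blast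
    have "f n \<in> N" if "n \<in> E" "(s e, n) \<in> q" for n
      using past[OF e(1) that] near[OF e(1,2)] antimono[OF b(1) e(1,3)] b(2) WN by blast
    then show "\<exists>d\<in>E. \<forall>n\<in>E. (d, n) \<in> q \<longrightarrow> f n \<in> N"
      using sE[OF e(1)] by blast
  qed
  then show "\<exists>x. net_convergent E q f x" ..
qed


section \<open>Two directed bases\<close>

lemma directed_entourages:
  "directed_set (entourages :: ('a::uniform_space \<times> 'a) set set)
     {(U, W). U \<in> entourages \<and> W \<in> entourages \<and> W \<subseteq> U}"
proof -
  have "(UNIV :: ('a \<times> 'a) set) \<in> entourages"
    by (simp add: entourages_def sym_def)
  moreover have "\<exists>W\<in>entourages. W \<subseteq> U \<and> W \<subseteq> U'"
    if "U \<in> entourages" "U' \<in> entourages" for U U' :: "('a \<times> 'a) set"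
    using entourage_Int[OF that] by (intro bexI[of _ "U \<inter> U'"]) auto
  ultimately show ?thesis
    unfolding directed_set_def preorder_on_def refl_on_def trans_def by fast
qed

lemma directed_nat: "directed_set (UNIV :: nat set) {(m, n). m \<le> n}"
proof -
  have "\<exists>c. a \<le> c \<and> b \<le> c" for a b :: nat
    by (intro exI[of _ "max a b"]) simp
  then show ?thesis
    unfolding directed_set_def preorder_on_def by (auto simp: refl_on_def trans_def)
qed

lemma dist_band_entourage:
  assumes "e > 0"
  shows "{(x :: 'a::metric_space, y). dist x y < e} \<in> entourages"
  using assms by (auto simp: entourages_def eventually_uniformity_metric sym_def dist_commute)

lemma metric_entourage_base:
  fixes U :: "('a::metric_space \<times> 'a) set"
  assumes "U \<in> entourages"
  shows "\<exists>k. {(x, y). dist x y < 1 / real (Suc k)} \<subseteq> U"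
proof -
  obtain e where "e > 0" and e: "\<And>x y. dist x y < e \<Longrightarrow> (x, y) \<in> U"
    using assms by (auto simp: entourages_def eventually_uniformity_metric)
  obtain k where "1 / real (Suc k) < e"
    using nat_approx_posE[OF \<open>e > 0\<close>] .
  then show ?thesis
    using e by (intro exI[of _ k]) auto
qed


section \<open>Completeness from convergence of ideal Cauchy nets\<close>

theorem corollary4p9:
  shows
    "((\<forall>(D :: ('a::{uniform_space, t2_space} \<times> 'a) set set) r. directed_set D r \<longrightarrow>
         (\<exists>I K. admissible D r I \<and> admissible D r K \<and>
            (\<forall>x :: ('a \<times> 'a) set \<Rightarrow> 'a. IK_Cauchy D I K x \<longrightarrow> (\<exists>p. IK_convergent D I K x p))))
      \<longrightarrow> net_complete TYPE('e) TYPE('a))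
     \<and>
     ((\<exists>I K. admissible (UNIV :: nat set) {(m, n). m \<le> n} I \<and>
             admissible (UNIV :: nat set) {(m, n). m \<le> n} K \<and>
         (\<forall>x :: nat \<Rightarrow> 'b::metric_space.
            IK_Cauchy UNIV I K x \<longrightarrow> (\<exists>p. IK_convergent UNIV I K x p)))
      \<longrightarrow> net_complete TYPE('e) TYPE('b))"
proof (intro conjI impI)
  let ?D = "entourages :: ('a \<times> 'a) set set"
  let ?r = "{(U, W). U \<in> ?D \<and> W \<in> ?D \<and> W \<subseteq> U}"
  assume complete: "\<forall>(D :: ('a \<times> 'a) set set) r. directed_set D r \<longrightarrow>
         (\<exists>I K. admissible D r I \<and> admissible D r K \<and>
            (\<forall>x :: ('a \<times> 'a) set \<Rightarrow> 'a. IK_Cauchy D I K x \<longrightarrow> (\<exists>p. IK_convergent D I K x p)))"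
  obtain I K where I: "admissible ?D ?r I" and K: "admissible ?D ?r K"
    and conv: "\<And>x :: ('a \<times> 'a) set \<Rightarrow> 'a. IK_Cauchy ?D I K x \<Longrightarrow> \<exists>p. IK_convergent ?D I K x p"
    using complete[THEN spec, THEN spec, THEN mp, OF directed_entourages] by blast
  show "net_complete TYPE('e) TYPE('a)"
  proof (rule net_complete_if_base_nets_converge[where V = "\<lambda>U. U", OF directed_entourages])
    fix g :: "('a \<times> 'a) set \<Rightarrow> 'a" assume "Cauchy_net ?D ?r g"
    then show "\<exists>x. net_convergent ?D ?r g x"
      using Cauchy_net_convergent_if_IK_complete[OF directed_entourages I K] conv by blast
  qed auto
next
  let ?r = "{(m, n). m \<le> n} :: nat rel"
  assume "\<exists>I K. admissible (UNIV :: nat set) ?r I \<and> admissible (UNIV :: nat set) ?r K \<and>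
         (\<forall>x :: nat \<Rightarrow> 'b. IK_Cauchy UNIV I K x \<longrightarrow> (\<exists>p. IK_convergent UNIV I K x p))"
  then obtain I K where I: "admissible UNIV ?r I" and K: "admissible UNIV ?r K"
    and conv: "\<And>x :: nat \<Rightarrow> 'b. IK_Cauchy UNIV I K x \<Longrightarrow> \<exists>p. IK_convergent UNIV I K x p"
    by blast
  let ?V = "\<lambda>k. {(x :: 'b, y). dist x y < 1 / real (Suc k)}"
  show "net_complete TYPE('e) TYPE('b)"
  proof (rule net_complete_if_base_nets_converge[where V = ?V, OF directed_nat])
    fix m n :: nat assume "(m, n) \<in> ?r"
    then have "1 / real (Suc n) \<le> 1 / real (Suc m)"
      by (simp add: frac_le)
    then show "?V n \<subseteq> ?V m"
      by auto
  next
    fix g :: "nat \<Rightarrow> 'b" assume "Cauchy_net UNIV ?r g"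
    then show "\<exists>x. net_convergent UNIV ?r g x"
      using Cauchy_net_convergent_if_IK_complete[OF directed_nat I K] conv by blast
  next
    show "\<exists>k\<in>UNIV. ?V k \<subseteq> U" if "U \<in> entourages" for U
      using metric_entourage_base[OF that] by simp
  qed (simp add: dist_band_entourage del: of_nat_Suc)
qed

end
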